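(* Let $m\ge 1$ and $t\ge 0$ be integers and let $0<\rho\le 1$. Consider the deterministic Fukui–Ishibashi traffic cellular automaton with maximum speed $m$ on the infinite lattice $\mathbb{Z}$, started at time $0$ from the random configuration in which the sites are independently occupied with probability $\rho$ and empty with probability $1-\rho$. Then the average flow at time $t$ is $$\phi_m(t) = 1-\rho-\sum_{j=1}^{t+1}\frac{j}{t+1}\binom{(m+1)(t+1)}{t+1-j}\rho^{\,t+1-j}(1-\rho)^{m(t+1)+j},$$ and, equivalently, $$\phi_m(t)=1-\rho-\frac{(1-\rho)^{1+m+mt}\,\rho^{t}\,(1+m+t+mt)!}{(1+m+mt)\,(1+t)!\,(m+mt)!}\;{}_2F_1\!\left(2,-t;\,2+m+mt;\,1-\frac1\rho\right).$$
   Context: Fukui–Ishibashi (F-I) model with maximum speed $m$: each site of $\mathbb{Z}$ is occupied by a car (state 1) or empty (state 0). At every discrete time step all cars simultaneously move to the right: a car having exactly $g$ empty sites between itself and the next car to its right advances by $\min(g,m)$ sites. Equivalently, it is the cellular automaton $s(i,t+1)=f_m(s(i-m,t),\ldots,s(i+1,t))$ where $s(i,t+1)=1$ if and only if one of the following holds at time $t$: (a) $s(i)=1$ and $s(i+1)=1$; (b) $s(i)=0$, $s(i+1)=1$ and $s(i-j)=1$ for some $1\le j\le m$; (c) $s(i)=0$, $s(i-m)=1$ and $s(i-j)=0$ for all $1\le j\le m-1$. For a finite binary block $B$, $P_t(B)$ denotes the probability that $B$ occurs at a given position (say starting at site $0$) of the configuration at time $t$; it does not depend on the position by translation invariance. $0^k$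 denotes $k$ consecutive zeros. The average flow (density $\rho$ times average car velocity) is $$\phi_m(t)=\sum_{k=1}^{m-1}k\,P_t(10^k1)+m\,P_t(10^m).$$ ${}_2F_1(a,b;c;z)=\sum_{l\ge0}\frac{(a)_l(b)_l}{(c)_l}\frac{z^l}{l!}$, with $(a)_l$ the rising factorial, is the Gauss hypergeometric function (here a finite sum since $b=-t$). The convention $0^0=1$ is used. *)

theory Defs
  imports "HOL-Probability.Probability"
begin

type_synonym config = "int \<Rightarrow> bool"

definition fi_step :: "nat \<Rightarrow> config \<Rightarrow> config" where
  "fi_step m s = (\<lambda>i.
      (s i \<and> s (i + 1))
    \<or> (\<not> s i \<and> s (i + 1) \<and> (\<exists>j\<in>{1..m}. s (i - int j)))
    \<or> (\<not> s i \<and> s (i - int m) \<and> (\<forall>j\<in>{1..<m}. \<not> s (i - int j))))"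

text \<open>
  The same rule in terms of moving cars: site \<open>i\<close> is occupied after the step iff some car at
  \<open>i - d\<close> advances by exactly \<open>d = min g m\<close>, where \<open>g\<close> (possibly infinite) is the gap in
  front of it.
\<close>

lemma fi_step_iff_car_moves:
  assumes "m \<ge> 1"
  shows "fi_step m s i \<longleftrightarrow>
    (\<exists>d\<le>m. s (i - int d) \<and> (\<forall>k\<in>{1..d}. \<not> s (i - int d + int k)) \<and>
            (d = m \<or> s (i + 1)))"
    (is "?L \<longleftrightarrow> ?R")
proof
  assume ?L
  then consider (a) "s i" "s (i + 1)"
    | (b) "\<not> s i" "s (i + 1)" "\<exists>j\<in>{1..m}. s (i - int j)"
    | (c) "\<not> s i" "s (i - int m)" "\<forall>j\<in>{1..<m}. \<not> s (i - int j)"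
    unfolding fi_step_def by blast
  then show ?R
  proof cases
    case a
    then show ?thesis by (intro exI[of _ 0]) auto
  next
    case b
    define d where "d = (LEAST j. 1 \<le> j \<and> j \<le> m \<and> s (i - int j))"
    have ex: "\<exists>j. 1 \<le> j \<and> j \<le> m \<and> s (i - int j)" using b by auto
    have d: "1 \<le> d \<and> d \<le> m \<and> s (i - int d)"
      unfolding d_def using LeastI_ex[OF ex] .
    have "\<not> s (i - int d + int k)" if k: "k \<in> {1..d}" for k
    proof (cases "k = d")
      case True
      then show ?thesis using b by simp
    next
      case False
      with k have "d - k < d" "1 \<le> d - k" by auto
      with d have "\<not> s (i - int (d - k))"
        using not_less_Least[of "d - k" "\<lambda>j. 1 \<le> j \<and> j \<le> m \<and> s (i - int j)",
          folded d_def]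
        by linarith
      then show ?thesis using k by (simp add: of_nat_diff algebra_simps)
    qed
    then show ?thesis using d b by blast
  next
    case c
    have "\<not> s (i - int m + int k)" if k: "k \<in> {1..m}" for k
    proof (cases "k = m")
      case True
      then show ?thesis using c by simp
    next
      case False
      with k have "m - k \<in> {1..<m}" by auto
      with c have "\<not> s (i - int (m - k))" by blast
      then show ?thesis using k by (simp add: of_nat_diff algebra_simps)
    qed
    then show ?thesis using c by blast
  qed
next
  assume ?R
  then obtain d where d: "d \<le> m" "s (i - int d)"
    "\<forall>k\<in>{1..d}. \<not> s (i - int d + int k)" "d = m \<or> s (i + 1)" by blast
  show ?L
  proof (cases "d = 0")
    case True
    then show ?thesis using d assms by (auto simp: fi_step_def)
  next
    case False
    then have ni: "\<not> s i" using d(3)[rule_format, of d] by simp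
    show ?thesis
    proof (cases "s (i + 1)")
      case True
      then show ?thesis using ni d False by (auto simp: fi_step_def)
    next
      case nn: False
      then have dm: "d = m" using d by blast
      have "\<not> s (i - int j)" if j: "j \<in> {1..<m}" for j
      proof -
        have "m - j \<in> {1..d}" using j dm by auto
        with d(3) have "\<not> s (i - int d + int (m - j))" by blast
        then show ?thesis using j by (simp add: dm of_nat_diff)
      qed
      then show ?thesis using ni d dm by (auto simp: fi_step_def)
    qed
  qed
qed

definition bernoulli_config :: "real \<Rightarrow> config measure" where
  "bernoulli_config \<rho> = (\<Pi>\<^sub>M i\<in>UNIV. measure_pmf (bernoulli_pmf \<rho>))"

definition block_at :: "bool list \<Rightarrow> int \<Rightarrow> config \<Rightarrow> bool" where
  "block_at B i s \<longleftrightarrow> (\<forall>k<length B. s (i + int k) = B ! k)"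

definition block_prob :: "nat \<Rightarrow> real \<Rightarrow> nat \<Rightarrow> bool list \<Rightarrow> real" where
  "block_prob m \<rho> t B =
     measure (bernoulli_config \<rho>)
       {s \<in> space (bernoulli_config \<rho>). block_at B 0 ((fi_step m ^^ t) s)}"

lemma space_bernoulli_config [simp]: "space (bernoulli_config \<rho>) = UNIV"
  by (simp add: bernoulli_config_def space_PiM)

lemma measurable_fi_iter:
  "(\<lambda>s. (fi_step m ^^ t) s i) \<in> bernoulli_config \<rho> \<rightarrow>\<^sub>M count_space UNIV"
proof (induction t arbitrary: i)
  case 0
  have "(\<lambda>s. s i) \<in> bernoulli_config \<rho> \<rightarrow>\<^sub>M measure_pmf (bernoulli_pmf \<rho>)"
    unfolding bernoulli_config_def by (rule measurable_component_singleton) simp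
  then show ?case by simp
next
  case (Suc t)
  note [measurable] = Suc
  have "(\<lambda>s. (fi_step m ^^ Suc t) s i) = (\<lambda>s. let c = (fi_step m ^^ t) s in
      (c i \<and> c (i + 1))
    \<or> (\<not> c i \<and> c (i + 1) \<and> (\<exists>j\<in>{1..m}. c (i - int j)))
    \<or> (\<not> c i \<and> c (i - int m) \<and> (\<forall>j\<in>{1..<m}. \<not> c (i - int j))))"
    by (simp add: fi_step_def[of m "(fi_step m ^^ t) _"] Let_def)
  also have "\<dots> \<in> bernoulli_config \<rho> \<rightarrow>\<^sub>M count_space UNIV"
    unfolding Let_def by measurable
  finally show ?case .
qed

lemma sets_block_at:
  "{s \<in> space (bernoulli_config \<rho>). block_at B i ((fi_step m ^^ t) s)}
     \<in> sets (bernoulli_config \<rho>)"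
proof -
  note [measurable] = measurable_fi_iter
  show ?thesis unfolding block_at_def by measurable
qed

definition avg_flow :: "nat \<Rightarrow> real \<Rightarrow> nat \<Rightarrow> real" where
  "avg_flow m \<rho> t =
     (\<Sum>k\<in>{1..<m}. real k * block_prob m \<rho> t (True # replicate k False @ [True]))
     + real m * block_prob m \<rho> t (True # replicate m False)"

definition hyp2F1 :: "real \<Rightarrow> real \<Rightarrow> real \<Rightarrow> real \<Rightarrow> real" where
  "hyp2F1 a b c z =
     (\<Sum>l. pochhammer a l * pochhammer b l / pochhammer c l * (z ^ l / fact l))"

lemma hyp2F1_eq_eval_fps: "hyp2F1 a b c z = eval_fps (fps_hypergeo [a, b] [c] 1) z"
  by (simp add: hyp2F1_def eval_fps_def fps_hypergeo_nth)

end

theory Submission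
  imports Defs
begin

text \<open>
  Every empty site that has a car within distance \<open>m\<close> to its left is crossed by exactly one
  car, so the average flow is the probability of such a site. Since the current conserves
  density, this probability is \<open>1 - \<rho>\<close> minus the probability that \<open>m + 1\<close> consecutive
  sites are empty.

  For the car-counting function \<open>N\<close> of a configuration, one step of the automaton is the
  max-plus evolution \<open>N x \<leadsto> max (N (x - m)) (N (x + 1) - 1)\<close>. Under it, the condition that
  every nonempty prefix of a block of length \<open>(m + 1) * n\<close> has density below \<open>1 / (m + 1)\<close>
  pulls back to the same condition on a block of length \<open>(m + 1) * (n + 1)\<close> starting \<open>m\<close>
  sites further left. For \<open>n = 1\<close> the condition says that the block is empty; after \<open>t\<close> steps
  it becomes a ballot condition on \<open>(m + 1) * (t + 1)\<close> independent sites, and the ballot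
  numbers are counted by Pascal's rule.
\<close>

section \<open>Max-plus form of the dynamics\<close>

text \<open>This is the current through the bond from \<open>x - 1\<close> to \<open>x\<close>. Cars
  do not overtake and none passes an occupied site, so at most one car crosses a bond per step and a
  truth value suffices.\<close>

definition moves_across :: "nat \<Rightarrow> config \<Rightarrow> int \<Rightarrow> bool" where
  "moves_across m s x \<longleftrightarrow> \<not> s x \<and> (\<exists>j\<in>{1..m}. s (x - int j))"

text \<open>Increment of the counting function, kept in \<open>int\<close> so that the -1 in the
  max-plus rule is a true subtraction.\<close>

definition ncars :: "config \<Rightarrow> int \<Rightarrow> nat \<Rightarrow> int" where
  "ncars s a k = (\<Sum>i<k. of_bool (s (a + int i)))"

text \<open>Ballot condition: the walk that steps +1 at an empty site and -m at a car stays positive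
  during its first \<open>n\<close> steps.\<close>

definition sparse_from :: "nat \<Rightarrow> config \<Rightarrow> int \<Rightarrow> nat \<Rightarrow> bool" where
  "sparse_from m s a n \<longleftrightarrow> (\<forall>k\<in>{1..n}. int (m + 1) * ncars s a k < int k)"

lemma ncars_0 [simp]: "ncars s a 0 = 0"
  by (simp add: ncars_def)

lemma ncars_Suc: "ncars s a (Suc k) = ncars s a k + of_bool (s (a + int k))"
  by (simp add: ncars_def)

lemma ncars_add: "ncars s a (j + k) = ncars s a j + ncars s (a + int j) k"
  by (induction k) (simp_all add: ncars_Suc ac_simps)

lemma ncars_nonneg: "0 \<le> ncars s a k"
  by (simp add: ncars_def sum_nonneg)

lemma ncars_mono: "j \<le> k \<Longrightarrow> ncars s a j \<le> ncars s a k"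
  unfolding ncars_def by (rule sum_mono2) auto

lemma ncars_eq_0_iff: "ncars s a k = 0 \<longleftrightarrow> (\<forall>i<k. \<not> s (a + int i))"
  by (auto simp: ncars_def sum_nonneg_eq_0_iff)

lemma ncars_eq_card: "ncars s a k = int (card {i. i < k \<and> s (a + int i)})"
proof -
  have "{..<k} \<inter> {i. s (a + int i)} = {i. i < k \<and> s (a + int i)}" by auto
  then show ?thesis
    unfolding ncars_def by (simp add: sum_of_bool_eq)
qed

text \<open>Discrete continuity equation: old content plus inflow equals new content plus outflow.
  It reduces to a finite case check on \<open>s x\<close>, \<open>s (x + 1)\<close>,
  \<open>s (x - int m)\<close> and \<open>Q\<close>.\<close>

lemma fi_step_conservation:
  assumes "m \<ge> 1"
  shows "of_bool (fi_step m s x) + of_bool (moves_across m s (x + 1))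
           = (of_bool (s x) + of_bool (moves_across m s x) :: int)"
proof -
  \<comment> \<open>The windows of \<open>m\<close> sites behind \<open>x\<close> and behind
    \<open>x + 1\<close> overlap exactly in the sites that \<open>Q\<close> inspects.\<close>
  define Q where "Q \<longleftrightarrow> (\<exists>j\<in>{1..<m}. s (x - int j))"
  have a: "(\<exists>j\<in>{1..m}. s (x - int j)) \<longleftrightarrow> Q \<or> s (x - int m)"
    using assms unfolding Q_def by (auto simp: le_less)
  have b: "(\<exists>j\<in>{1..m}. s (x + 1 - int j)) \<longleftrightarrow> s x \<or> Q"
  proof -
    have "{1..m} = insert 1 (Suc ` {1..<m})"
      using assms by (simp only: image_Suc_atLeastLessThan) auto
    then show ?thesis unfolding Q_def by (simp del: image_Suc_atLeastLessThan)
  qed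
  have c: "(\<forall>j\<in>{1..<m}. \<not> s (x - int j)) \<longleftrightarrow> \<not> Q"
    unfolding Q_def by blast
  show ?thesis
    unfolding fi_step_def moves_across_def a b c by auto
qed

text \<open>Summing the continuity equation over the block telescopes, leaving only the currents at
  its two ends.\<close>

lemma ncars_fi_step:
  assumes "m \<ge> 1"
  shows "ncars (fi_step m s) a k
           = ncars s a k + of_bool (moves_across m s a) - of_bool (moves_across m s (a + int k))"
proof (induction k)
  case (Suc k)
  have "a + int (Suc k) = a + int k + 1" by simp
  then show ?case
    using Suc fi_step_conservation[OF assms, of s "a + int k"]
    unfolding ncars_Suc by (simp only:)
qed simp

text \<open>Writing the current as a minimum is what makes the evolution max-plus: subtracting a
  minimum from a count produces a maximum.\<close>

lemma moves_across_conv_ncars: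
  "of_bool (moves_across m s (a + int m)) = min (ncars s a m) (1 - of_bool (s (a + int m)))"
proof -
  have "(\<exists>j\<in>{1..m}. s (a + int m - int j)) \<longleftrightarrow> (\<exists>i<m. s (a + int i))"
  proof safe
    fix j assume "j \<in> {1..m}" "s (a + int m - int j)"
    then show "\<exists>i<m. s (a + int i)"
      by (intro exI[of _ "m - j"]) (auto simp: of_nat_diff algebra_simps)
  next
    fix i assume "i < m" "s (a + int i)"
    then show "\<exists>j\<in>{1..m}. s (a + int m - int j)"
      by (intro bexI[of _ "m - i"]) (auto simp: of_nat_diff algebra_simps)
  qed
  then have "moves_across m s (a + int m) \<longleftrightarrow> \<not> s (a + int m) \<and> ncars s a m \<noteq> 0"
    by (auto simp: moves_across_def ncars_eq_0_iff)
  then show ?thesis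
    using ncars_nonneg[of s a m] by (auto simp: min_def)
qed

text \<open>\<open>M s a k\<close> is the count up to \<open>a + m + k\<close> minus the current
  there; subtracting \<open>M s a 0\<close> makes the new count start at 0. The shift by
  \<open>m\<close> reflects that the current looks \<open>m\<close> sites back.\<close>

lemma ncars_fi_step_max:
  assumes "m \<ge> 1"
  defines "M \<equiv> \<lambda>s a k. max (ncars s a k) (ncars s a (k + m + 1) - 1)"
  shows "ncars (fi_step m s) (a + int m) k = M s a k - M s a 0"
proof -
  have *: "ncars s a (m + k) - of_bool (moves_across m s (a + int m + int k)) = M s a k" for k
  proof -
    have "a + int m + int k = a + int k + int m" "k + m + 1 = Suc (k + m)" "m + k = k + m"
      by simp_all
    then show ?thesis
      using moves_across_conv_ncars[of m s "a + int k"] ncars_add[of s a k m]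
      unfolding M_def by (simp only: ncars_Suc) (auto simp: min_def max_def add_ac)
  qed
  show ?thesis
    using ncars_fi_step[OF assms(1), of s "a + int m" k] *[of k] *[of 0] ncars_add[of s a m k]
    by simp
qed

lemma sparse_fromD:
  "sparse_from m s a n \<Longrightarrow> 1 \<le> k \<Longrightarrow> k \<le> n \<Longrightarrow> int (m + 1) * ncars s a k < int k"
  by (auto simp: sparse_from_def)

text \<open>At prefix length \<open>m + 1\<close> the condition bounds a nonnegative integer
  strictly below 1.\<close>

lemma sparse_from_initial:
  assumes "sparse_from m s a n" "m + 1 \<le> n"
  shows "ncars s a (m + 1) = 0"
proof -
  have "int (m + 1) * ncars s a (m + 1) < int (m + 1) * 1"
    using sparse_fromD[OF assms(1), of "m + 1"] assms(2) by simp
  then have "ncars s a (m + 1) < 1" by (subst (asm) mult_less_cancel_left_pos) auto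
  then show ?thesis using ncars_nonneg[of s a "m + 1"] by simp
qed

lemma sparse_from_self: "sparse_from m s a (m + 1) \<longleftrightarrow> (\<forall>i\<le>m. \<not> s (a + int i))"
proof
  assume "sparse_from m s a (m + 1)"
  then show "\<forall>i\<le>m. \<not> s (a + int i)"
    using sparse_from_initial[of m s a "m + 1"] by (auto simp: ncars_eq_0_iff)
next
  assume "\<forall>i\<le>m. \<not> s (a + int i)"
  then have "ncars s a k = 0" if "k \<le> m + 1" for k
    using that by (auto simp: ncars_eq_0_iff)
  then show "sparse_from m s a (m + 1)" by (auto simp: sparse_from_def)
qed

text \<open>Either condition forces the first \<open>m + 1\<close> old sites to be empty, so the
  normalising term vanishes and \<open>T' k\<close> is the maximum of \<open>T k\<close> and
  \<open>T (k + m + 1) - 1\<close>. Bounding this maximum by \<open>k / (m + 1)\<close> is the old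
  condition at the prefixes \<open>k\<close> and \<open>k + m + 1\<close>.\<close>

lemma sparse_from_fi_step:
  assumes m: "m \<ge> 1" and n: "n \<ge> 1"
  shows "sparse_from m (fi_step m s) (a + int m) ((m + 1) * n)
           \<longleftrightarrow> sparse_from m s a ((m + 1) * (n + 1))"
proof
  define T where "T = ncars s a"
  define T' where "T' = ncars (fi_step m s) (a + int m)"
  have T': "T' k = max (T k) (T (k + m + 1) - 1) - max (T 0) (T (0 + m + 1) - 1)" for k
    unfolding T_def T'_def by (rule ncars_fi_step_max[OF m])
  have T0: "T 0 = 0" and Tmono: "\<And>j k. j \<le> k \<Longrightarrow> T j \<le> T k"
    unfolding T_def by (simp_all add: ncars_mono)
  have Tm: "T (m + 1) \<ge> 0" unfolding T_def by (rule ncars_nonneg)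
  {
    assume sp: "sparse_from m s a ((m + 1) * (n + 1))"
    have z: "T (m + 1) = 0"
      unfolding T_def using sparse_from_initial[OF sp] by simp
    have "int (m + 1) * T' k < int k" if k: "k \<in> {1..(m + 1) * n}" for k
    proof -
      have "int (m + 1) * T k < int k"
        unfolding T_def by (rule sparse_fromD[OF sp]) (use k in auto)
      moreover have "int (m + 1) * T (k + m + 1) < int (k + m + 1)"
        unfolding T_def by (rule sparse_fromD[OF sp]) (use k in auto)
      ultimately have "int (m + 1) * T k < int k" "int (m + 1) * (T (k + m + 1) - 1) < int k"
        by (auto simp: algebra_simps)
      moreover have "T' k = max (T k) (T (k + m + 1) - 1)" using T'[of k] T0 z by simp
      ultimately show ?thesis by (simp add: max_def)
    qed
    then show "sparse_from m (fi_step m s) (a + int m) ((m + 1) * n)"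
      by (auto simp: sparse_from_def T'_def)
  }
  {
    assume sp: "sparse_from m (fi_step m s) (a + int m) ((m + 1) * n)"
    have "T' (m + 1) = 0"
      unfolding T'_def by (rule sparse_from_initial[OF sp]) (use n in \<open>cases n; simp\<close>)
    \<comment> \<open>If \<open>T (m + 1)\<close> were at least 1, the subtracted maximum would be
      \<open>T (m + 1) - 1\<close>, so \<open>T' (m + 1)\<close> would be at least 1.\<close>
    then have z: "T (m + 1) = 0" using T'[of "m + 1"] T0 Tm by auto
    have "int (m + 1) * T k < int k" if k: "k \<in> {1..(m + 1) * (n + 1)}" for k
    \<comment> \<open>Short prefixes lie inside the empty initial stretch; longer ones are
      controlled by the new condition at \<open>k - (m + 1)\<close>.\<close>
    proof (cases "k \<le> m + 1")
      case True
      then have "T k \<le> 0" using Tmono[OF True] z by simp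
      then have "int (m + 1) * T k \<le> 0" by (intro mult_nonneg_nonpos) auto
      then show ?thesis using k by simp
    next
      case False
      define i where "i = k - (m + 1)"
      have i: "k = i + m + 1" "i \<in> {1..(m + 1) * n}" using False k by (auto simp: i_def)
      have "int (m + 1) * T' i < int i"
        unfolding T'_def by (rule sparse_fromD[OF sp]) (use i in auto)
      moreover have "T k - 1 \<le> T' i" using T'[of i] T0 z i by simp
      then have "int (m + 1) * (T k - 1) \<le> int (m + 1) * T' i" by (rule mult_left_mono) simp
      ultimately show ?thesis using i by (simp add: algebra_simps)
    qed
    then show "sparse_from m s a ((m + 1) * (n + 1))"
      by (auto simp: sparse_from_def T_def)
  }
qed

lemma empty_block_iff_sparse_from:
  assumes m: "m \<ge> 1"
  shows "(\<forall>i\<le>m. \<not> (fi_step m ^^ t) s (a + int (m * t) + int i))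
           \<longleftrightarrow> sparse_from m s a ((m + 1) * (t + 1))"
proof -
  \<comment> \<open>General \<open>n\<close> is carried along because each step back in time
    lengthens the block by \<open>m + 1\<close>.\<close>
  have "sparse_from m ((fi_step m ^^ t) s) (a + int (m * t)) ((m + 1) * n)
          \<longleftrightarrow> sparse_from m s a ((m + 1) * (n + t))" if "n \<ge> 1" for n
    using that
  proof (induction t arbitrary: n)
    case (Suc t)
    have "a + int (m * Suc t) = a + int (m * t) + int m" by (simp add: algebra_simps)
    then show ?case
      using sparse_from_fi_step[OF m Suc.prems, of "(fi_step m ^^ t) s" "a + int (m * t)"]
        Suc.IH[of "n + 1"] by (simp add: ac_simps)
  qed simp
  from this[of 1] show ?thesis
    using sparse_from_self[of m "(fi_step m ^^ t) s" "a + int (m * t)"] by (simp add: add.commute)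
qed

section \<open>Ballot numbers\<close>

text \<open>Ballot sequences encoded by their car positions, graded by the number \<open>k\<close>
  of cars because the Bernoulli weight depends only on \<open>k\<close>.\<close>

definition sparse_sets :: "nat \<Rightarrow> nat \<Rightarrow> nat \<Rightarrow> nat set set" where
  "sparse_sets m n k = {A. A \<subseteq> {..<n} \<and> card A = k \<and>
     (\<forall>j\<in>{1..n}. (m + 1) * card (A \<inter> {..<j}) < j)}"

lemma finite_sparse_sets [simp]: "finite (sparse_sets m n k)"
  by (rule finite_subset[of _ "Pow {..<n}"]) (auto simp: sparse_sets_def)

text \<open>The prefix condition fails already for the whole block.\<close>

lemma sparse_sets_empty: "0 < n \<Longrightarrow> n \<le> (m + 1) * k \<Longrightarrow> sparse_sets m n k = {}"
proof (rule equals0I)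
  fix A assume n: "0 < n" "n \<le> (m + 1) * k" and A: "A \<in> sparse_sets m n k"
  then have "A \<inter> {..<n} = A" "card A = k" by (auto simp: sparse_sets_def)
  moreover have "(m + 1) * card (A \<inter> {..<n}) < n"
    using A n(1) unfolding sparse_sets_def by (elim CollectE conjE bspec) simp
  ultimately show False using n(2) by simp
qed

lemma sparse_sets_0: "sparse_sets m n 0 = {{}}"
  by (auto simp: sparse_sets_def finite_subset[OF _ finite_lessThan])

text \<open>Split by whether the last site \<open>n\<close> carries a car. The assumption supplies
  the condition at the full prefix \<open>Suc n\<close>, which the two smaller families do not
  impose.\<close>

lemma sparse_sets_Suc:
  assumes "(m + 1) * Suc k < Suc n"
  shows "sparse_sets m (Suc n) (Suc k) = sparse_sets m n (Suc k) \<union> insert n ` sparse_sets m n k"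
    (is "?L = ?R1 \<union> ?R2")
proof (intro equalityI subsetI)
  fix A assume A: "A \<in> ?L"
  then have sub: "A \<subseteq> {..<Suc n}" and card: "card A = Suc k"
    and cond: "\<And>j. 1 \<le> j \<Longrightarrow> j \<le> n \<Longrightarrow> (m + 1) * card (A \<inter> {..<j}) < j"
    by (auto simp: sparse_sets_def)
  show "A \<in> ?R1 \<union> ?R2"
  proof (cases "n \<in> A")
    case False
    then have "A \<subseteq> {..<n}" using sub by (auto simp: less_Suc_eq)
    then show ?thesis using card cond by (auto simp: sparse_sets_def)
  next
    case True
    define B where "B = A - {n}"
    have AB: "A = insert n B" using True by (auto simp: B_def)
    have "B \<subseteq> {..<n}" using sub by (auto simp: B_def less_Suc_eq)
    moreover have "card B = k" using True card by (simp add: B_def)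
    moreover have "A \<inter> {..<j} = B \<inter> {..<j}" if "j \<le> n" for j
      using that by (auto simp: B_def)
    ultimately have "B \<in> sparse_sets m n k"
      using cond by (auto simp: sparse_sets_def)
    then show ?thesis using AB by blast
  qed
next
  fix A assume "A \<in> ?R1 \<union> ?R2"
  then show "A \<in> ?L"
  proof
    assume A: "A \<in> ?R1"
    then have "A \<subseteq> {..<n}" by (simp add: sparse_sets_def)
    then have "A \<inter> {..<Suc n} = A" by auto
    then show ?thesis using A assms
      by (auto simp: sparse_sets_def atLeastAtMostSuc_conv)
  next
    assume "A \<in> ?R2"
    then obtain B where B: "B \<in> sparse_sets m n k" "A = insert n B" by blast
    then have sub: "B \<subseteq> {..<n}" by (simp add: sparse_sets_def)
    then have fin: "finite B" "n \<notin> B" using finite_subset by auto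
    have "A \<inter> {..<Suc n} = A" using sub B by auto
    moreover have "A \<inter> {..<j} = B \<inter> {..<j}" if "j \<le> n" for j
      using that B by auto
    ultimately show ?thesis using B assms fin
      by (auto simp: sparse_sets_def atLeastAtMostSuc_conv)
  qed
qed

lemma card_sparse_sets_Suc:
  assumes "(m + 1) * Suc k < Suc n"
  shows "card (sparse_sets m (Suc n) (Suc k))
           = card (sparse_sets m n (Suc k)) + card (sparse_sets m n k)"
proof -
  have n: "n \<notin> A" if "A \<in> sparse_sets m n j" for A j
    using that by (auto simp: sparse_sets_def)
  have "inj_on (insert n) (sparse_sets m n k)"
    by (rule inj_onI) (metis n insert_ident)
  moreover have "sparse_sets m n (Suc k) \<inter> insert n ` sparse_sets m n k = {}"
    using n by blast
  ultimately show ?thesis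
    by (simp add: sparse_sets_Suc[OF assms] card_Un_disjoint card_image)
qed

text \<open>Both sides satisfy Pascal's recurrence, and on the line
  \<open>(m + 1) * Suc k = Suc n\<close> both vanish.\<close>

lemma card_sparse_sets_binomial:
  assumes "(m + 1) * Suc k \<le> Suc n"
  shows "int (card (sparse_sets m (Suc n) (Suc k)))
           = int (Suc n choose Suc k) - int (m + 1) * int (n choose k)"
  using assms
proof (induction n arbitrary: k)
  case 0
  then have "m = 0" "k = 0" by simp_all
  then show ?case using sparse_sets_empty[of "Suc 0" 0 "Suc 0"] by simp
next
  case (Suc n)
  show ?case
  proof (cases "(m + 1) * Suc k = Suc (Suc n)")
    \<comment> \<open>On the boundary line the absorption identity makes the right-hand side zero,
      and there are no admissible sets.\<close>
    case True
    have "Suc k * (Suc (Suc n) choose Suc k) = Suc (Suc n) * (Suc n choose k)"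
      using Suc_times_binomial_eq[of "Suc n" k] by (simp only: mult.commute)
    also have "\<dots> = Suc k * ((m + 1) * (Suc n choose k))"
      unfolding True[symmetric] by (simp only: ac_simps)
    finally have "Suc (Suc n) choose Suc k = (m + 1) * (Suc n choose k)"
      by (simp only: mult_cancel1) simp
    moreover have "sparse_sets m (Suc (Suc n)) (Suc k) = {}"
      by (rule sparse_sets_empty) (use True in auto)
    ultimately show ?thesis by (simp only: card.empty of_nat_mult)
  next
    case False
    then have less: "(m + 1) * Suc k < Suc (Suc n)" using Suc.prems by linarith
    have IH: "int (card (sparse_sets m (Suc n) (Suc k)))
           = int (Suc n choose Suc k) - int (m + 1) * int (n choose k)"
      by (rule Suc.IH) (use less in linarith)
    show ?thesis
    \<comment> \<open>For \<open>k = 0\<close> the second summand of the recurrence counts just the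
      empty set, to which the induction hypothesis does not apply.\<close>
    proof (cases k)
      case 0
      then show ?thesis
        using IH card_sparse_sets_Suc[OF less] by (simp add: sparse_sets_0)
    next
      case k: (Suc k')
      have "(m + 1) * Suc k' \<le> (m + 1) * Suc k" using k by simp
      then have "int (card (sparse_sets m (Suc n) (Suc k')))
           = int (Suc n choose Suc k') - int (m + 1) * int (n choose k')"
        by (intro Suc.IH) (use less in linarith)
      then show ?thesis
        using IH card_sparse_sets_Suc[OF less] k by (simp add: algebra_simps)
    qed
  qed
qed

lemma card_sparse_sets:
  assumes "k \<le> r" "r > 0"
  shows "real (card (sparse_sets m ((m + 1) * r) k))
           = real (r - k) / real r * real (((m + 1) * r) choose k)"
proof (cases k)
  case 0
  then show ?thesis using assms by (simp add: sparse_sets_0)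
next
  case (Suc k')
  obtain n where n: "(m + 1) * r = Suc n" using assms(2) by (cases "(m + 1) * r") auto
  have "int (card (sparse_sets m (Suc n) k)) = int (Suc n choose k) - int (m + 1) * int (n choose k')"
    unfolding Suc by (rule card_sparse_sets_binomial) (use assms Suc n in \<open>metis mult_le_mono2\<close>)
  then have "real_of_int (int (card (sparse_sets m (Suc n) k)))
      = real_of_int (int (Suc n choose k) - int (m + 1) * int (n choose k'))" by (rule arg_cong)
  then have 1: "real (card (sparse_sets m (Suc n) k))
      = real (Suc n choose k) - real (m + 1) * real (n choose k')" by simp
  \<comment> \<open>Since \<open>Suc n = (m + 1) * r\<close>, absorption turns the subtracted
    binomial into \<open>k / r\<close> times the first one.\<close>
  have "Suc n * (n choose k') = (Suc n choose k) * k"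
    unfolding Suc by (rule Suc_times_binomial_eq)
  then have "real (Suc n * (n choose k')) = real ((Suc n choose k) * k)" by (rule arg_cong)
  then have "real r * (real (m + 1) * real (n choose k')) = real k * real (Suc n choose k)"
    unfolding n[symmetric] by (simp only: of_nat_mult ac_simps)
  then have "real r * real (card (sparse_sets m (Suc n) k))
      = (real r - real k) * real (Suc n choose k)"
    unfolding 1 by (simp only: algebra_simps)
  then show ?thesis unfolding n using assms by (simp add: of_nat_diff field_simps)
qed

section \<open>Probabilities under the Bernoulli measure\<close>

text \<open>Fixing the state of \<open>n\<close> sites is a cylinder event, so its measure is a
  product of one-site probabilities.\<close>

lemma measure_occupied_set:
  assumes \<rho>: "0 \<le> \<rho>" "\<rho> \<le> 1" and A: "A \<subseteq> {..<n}"
  shows "measure (bernoulli_config \<rho>) {s. {i. i < n \<and> s (a + int i)} = A}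
           = \<rho> ^ card A * (1 - \<rho>) ^ (n - card A)"
proof -
  let ?M = "\<lambda>_::int. measure_pmf (bernoulli_pmf \<rho>)"
  interpret product_prob_space ?M "UNIV :: int set"
    by (rule product_prob_spaceI) (rule measure_pmf.prob_space_axioms)
  define f where "f i = a + int i" for i
  \<comment> \<open>The required state at site \<open>x\<close>, as a singleton;
    \<open>nat (x - a)\<close> recovers the index of the site in the block.\<close>
  define X where "X x = {nat (x - a) \<in> A}" for x
  have inj: "inj_on f {..<n}" by (auto simp: inj_on_def f_def)
  have "{i. i < n \<and> s (a + int i)} = A \<longleftrightarrow> (\<forall>x\<in>f ` {..<n}. s x \<in> X x)" for s
    using A by (auto simp: f_def X_def)
  then have "{s. {i. i < n \<and> s (a + int i)} = A}
      = prod_emb UNIV ?M (f ` {..<n}) (Pi\<^sub>E (f ` {..<n}) X)"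
    by (auto simp: prod_emb_def space_PiM restrict_PiE_iff Pi_iff)
  then have "measure (bernoulli_config \<rho>) {s. {i. i < n \<and> s (a + int i)} = A}
      = (\<Prod>x\<in>f ` {..<n}. measure (bernoulli_pmf \<rho>) (X x))"
    unfolding bernoulli_config_def by (simp only:) (rule measure_PiM_emb; simp)
  also have "\<dots> = (\<Prod>i<n. if i \<in> A then \<rho> else 1 - \<rho>)"
    unfolding prod.reindex[OF inj] using \<rho>
    by (intro prod.cong) (auto simp: f_def X_def measure_pmf_single)
  also have "\<dots> = \<rho> ^ card ({..<n} \<inter> A) * (1 - \<rho>) ^ card ({..<n} \<inter> - A)"
    by (simp add: prod.If_cases)
  also have "{..<n} \<inter> A = A" using A by auto
  also have "{..<n} \<inter> - A = {..<n} - A" by auto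
  also have "card \<dots> = n - card A"
    using A by (simp add: card_Diff_subset finite_subset)
  finally show ?thesis .
qed

lemma prob_space_bernoulli_config: "prob_space (bernoulli_config \<rho>)"
  unfolding bernoulli_config_def by (intro prob_space_PiM measure_pmf.prob_space_axioms)

lemma measurable_initial_car [measurable]:
  "(\<lambda>s. s i) \<in> bernoulli_config \<rho> \<rightarrow>\<^sub>M count_space UNIV"
  using measurable_fi_iter[of 0 0 i \<rho>] by simp

text \<open>Passes from configurations to finite sets of positions; more than \<open>r\<close> cars
  would violate the condition on the whole block, so \<open>k\<close> ranges only up to
  \<open>r\<close>.\<close>

lemma sparse_from_iff_sparse_sets:
  "sparse_from m s a ((m + 1) * r)
     \<longleftrightarrow> {i. i < (m + 1) * r \<and> s (a + int i)} \<in> (\<Union>k\<le>r. sparse_sets m ((m + 1) * r) k)"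
proof -
  let ?n = "(m + 1) * r" and ?A = "{i. i < (m + 1) * r \<and> s (a + int i)}"
  have "?A \<inter> {..<k} = {i. i < k \<and> s (a + int i)}" if "k \<le> ?n" for k
    using that by auto
  then have "sparse_from m s a ?n \<longleftrightarrow> (\<forall>k\<in>{1..?n}. int (m + 1) * int (card (?A \<inter> {..<k})) < int k)"
    unfolding sparse_from_def ncars_eq_card by auto
  also have "\<dots> \<longleftrightarrow> (\<forall>k\<in>{1..?n}. (m + 1) * card (?A \<inter> {..<k}) < k)"
    by (simp only: of_nat_mult[symmetric] of_nat_less_iff)
  also have "\<dots> \<longleftrightarrow> ?A \<in> sparse_sets m ?n (card ?A)"
    by (auto simp: sparse_sets_def)
  also have "\<dots> \<longleftrightarrow> ?A \<in> (\<Union>k\<le>r. sparse_sets m ?n k)"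
  proof
    assume *: "?A \<in> sparse_sets m ?n (card ?A)"
    have "card ?A \<le> r"
    proof (rule ccontr)
      assume c: "\<not> card ?A \<le> r"
      have "card ?A \<le> card {..<?n}" by (intro card_mono) auto
      then have "?n > 0" using c by (cases "r = 0") auto
      moreover have "?n \<le> (m + 1) * card ?A" using c by (intro mult_le_mono2) simp
      ultimately show False using * sparse_sets_empty by blast
    qed
    then show "?A \<in> (\<Union>k\<le>r. sparse_sets m ?n k)" using * by blast
  qed (auto simp: sparse_sets_def)
  finally show ?thesis .
qed

text \<open>Decompose by the exact set of occupied sites in the block; sets with equally many cars
  have equal weight, so only the ballot numbers enter.\<close>

lemma prob_sparse_from:
  assumes \<rho>: "0 \<le> \<rho>" "\<rho> \<le> 1" and r: "r > 0"
  shows "measure (bernoulli_config \<rho>) {s. sparse_from m s a ((m + 1) * r)}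
    = (\<Sum>k\<le>r. real (r - k) / real r * real (((m + 1) * r) choose k)
                * \<rho> ^ k * (1 - \<rho>) ^ ((m + 1) * r - k))"
proof -
  interpret prob_space "bernoulli_config \<rho>" by (rule prob_space_bernoulli_config)
  let ?n = "(m + 1) * r"
  define E where "E A = {s. {i. i < ?n \<and> s (a + int i)} = A}" for A
  have "{s. sparse_from m s a ?n} = (\<Union>A\<in>(\<Union>k\<le>r. sparse_sets m ?n k). E A)"
    unfolding sparse_from_iff_sparse_sets E_def by auto
  also have "prob \<dots> = (\<Sum>A\<in>(\<Union>k\<le>r. sparse_sets m ?n k). prob (E A))"
  proof (rule finite_measure_finite_Union)
    have "E A \<in> events" for A
    proof -
      have "E A = {s \<in> space (bernoulli_config \<rho>).
          (\<forall>i<?n. s (a + int i) \<longleftrightarrow> i \<in> A) \<and> (\<forall>i\<in>A. i < ?n)}"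
        unfolding E_def by auto
      also have "\<dots> \<in> events" by measurable
      finally show ?thesis .
    qed
    then show "E ` (\<Union>k\<le>r. sparse_sets m ?n k) \<subseteq> events" by blast
  qed (auto simp: disjoint_family_on_def E_def)
  also have "\<dots> = (\<Sum>k\<le>r. \<Sum>A\<in>sparse_sets m ?n k. prob (E A))"
    by (rule sum.UNION_disjoint) (auto simp: sparse_sets_def)
  also have "\<dots> = (\<Sum>k\<le>r. \<Sum>A\<in>sparse_sets m ?n k. \<rho> ^ k * (1 - \<rho>) ^ (?n - k))"
    unfolding E_def
    by (intro sum.cong refl) (simp add: measure_occupied_set[OF \<rho>] sparse_sets_def)
  also have "\<dots> = (\<Sum>k\<le>r. real (r - k) / real r * real (?n choose k)
                * \<rho> ^ k * (1 - \<rho>) ^ (?n - k))"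
    using card_sparse_sets[OF _ r, of _ m]
    by (intro sum.cong refl) (simp add: mult.assoc)
  finally show ?thesis .
qed

section \<open>Translation invariance and constancy of the density\<close>

lemma fi_iter_translate:
  "(fi_step m ^^ t) (\<lambda>i. s (i + a)) = (\<lambda>i. (fi_step m ^^ t) s (i + a))"
proof (induction t)
  case (Suc t)
  have "fi_step m (\<lambda>i. c (i + a)) = (\<lambda>i. fi_step m c (i + a))" for c
    unfolding fi_step_def by (simp add: algebra_simps)
  then show ?case using Suc by simp
qed simp

text \<open>A shift reindexes a product of identical factors along an injective map.\<close>

lemma measure_translate:
  assumes "{s. P s} \<in> sets (bernoulli_config \<rho>)"
  shows "measure (bernoulli_config \<rho>) {s. P (\<lambda>i. s (i + a))} = measure (bernoulli_config \<rho>) {s. P s}"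
proof -
  let ?T = "\<lambda>s i. s (i + a :: int) :: bool"
  have "distr (bernoulli_config \<rho>) (bernoulli_config \<rho>) ?T = bernoulli_config \<rho>"
    using distr_PiM_reindex[of UNIV "\<lambda>_. measure_pmf (bernoulli_pmf \<rho>)" "\<lambda>i. i + a" UNIV]
    by (simp add: bernoulli_config_def measure_pmf.prob_space_axioms restrict_UNIV)
  moreover have "?T \<in> bernoulli_config \<rho> \<rightarrow>\<^sub>M bernoulli_config \<rho>"
    unfolding bernoulli_config_def by (rule measurable_PiM_single') (use measurable_initial_car[unfolded bernoulli_config_def] in auto)
  ultimately have "measure (bernoulli_config \<rho>) {s. P s}
      = measure (bernoulli_config \<rho>) (?T -` {s. P s} \<inter> space (bernoulli_config \<rho>))"
    using measure_distr[of ?T "bernoulli_config \<rho>" "bernoulli_config \<rho>" "{s. P s}"] assms by simp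
  then show ?thesis by (simp add: vimage_def)
qed

lemma measure_fi_iter_translate:
  assumes "{s. Q ((fi_step m ^^ t) s)} \<in> sets (bernoulli_config \<rho>)"
  shows "measure (bernoulli_config \<rho>) {s. Q (\<lambda>i. (fi_step m ^^ t) s (i + a))}
           = measure (bernoulli_config \<rho>) {s. Q ((fi_step m ^^ t) s)}"
  using measure_translate[OF assms, of a] by (simp add: fi_iter_translate)

lemma block_prob_eq_measure_at:
  "block_prob m \<rho> t B = measure (bernoulli_config \<rho>) {s. block_at B x ((fi_step m ^^ t) s)}"
  using measure_fi_iter_translate[of "block_at B 0" t m \<rho> x] sets_block_at[of \<rho> B 0 t m]
  by (simp add: block_prob_def block_at_def add.commute)

lemma sets_fi_iter_occupied:
  "{s. (fi_step m ^^ t) s x} \<in> sets (bernoulli_config \<rho>)"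
proof -
  note [measurable] = measurable_fi_iter
  have "{s \<in> space (bernoulli_config \<rho>). (fi_step m ^^ t) s x} \<in> sets (bernoulli_config \<rho>)"
    by measurable
  then show ?thesis by simp
qed

lemma sets_moves_across:
  "{s. moves_across m ((fi_step m ^^ t) s) x} \<in> sets (bernoulli_config \<rho>)"
proof -
  note [measurable] = measurable_fi_iter
  have "{s \<in> space (bernoulli_config \<rho>). moves_across m ((fi_step m ^^ t) s) x}
      \<in> sets (bernoulli_config \<rho>)"
    unfolding moves_across_def by measurable
  then show ?thesis by simp
qed

text \<open>Take probabilities in the continuity equation: by translation invariance the currents at
  0 and 1 are equally likely and cancel.\<close>

lemma density_fi_iter:
  assumes m: "m \<ge> 1" and \<rho>: "0 \<le> \<rho>" "\<rho> \<le> 1"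
  shows "measure (bernoulli_config \<rho>) {s. (fi_step m ^^ t) s 0} = \<rho>"
proof (induction t)
  case 0
  have "s 0 \<longleftrightarrow> {i. i < Suc 0 \<and> s (0 + int i)} = {0}" for s :: config
    by (simp only: set_eq_iff mem_Collect_eq singleton_iff less_Suc0) (metis of_nat_0 add.right_neutral)
  then have "{s. s 0} = {s. {i. i < Suc 0 \<and> s (0 + int i)} = {0}}" by (rule Collect_cong)
  then show ?case using measure_occupied_set[OF \<rho>, of "{0}" "Suc 0" 0] by simp
next
  case (Suc t)
  interpret prob_space "bernoulli_config \<rho>" by (rule prob_space_bernoulli_config)
  define F where "F = (fi_step m ^^ t)"
  define A B C D where "A = {s. fi_step m (F s) 0}" and "B = {s. moves_across m (F s) 1}"
    and "C = {s. F s 0}" and "D = {s. moves_across m (F s) 0}"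
  have sets: "A \<in> events" "B \<in> events" "C \<in> events" "D \<in> events"
    unfolding A_def B_def C_def D_def F_def
    using sets_fi_iter_occupied[where m = m and t = "Suc t" and x = 0] by (auto simp: sets_fi_iter_occupied sets_moves_across)
  have sum: "prob X + prob Y = prob (X \<union> Y) + prob (X \<inter> Y)" if "X \<in> events" "Y \<in> events" for X Y
    using that finite_measure_Union'[of X Y] finite_measure_Diff'[of Y X] by (simp add: Int_commute)
  \<comment> \<open>Equal indicator sums mean equal unions and equal intersections, so
    inclusion-exclusion replaces taking expectations.\<close>
  have *: "of_bool (s \<in> A) + of_bool (s \<in> B) = (of_bool (s \<in> C) + of_bool (s \<in> D) :: int)" for s
    using fi_step_conservation[OF m, of "F s" 0] by (simp add: A_def B_def C_def D_def)
  have "s \<in> A \<union> B \<longleftrightarrow> s \<in> C \<union> D" "s \<in> A \<inter> B \<longleftrightarrow> s \<in> C \<inter> D" for s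
    using *[of s]
    by (cases "s \<in> A"; cases "s \<in> B"; cases "s \<in> C"; cases "s \<in> D"; simp)+
  then have "A \<union> B = C \<union> D" "A \<inter> B = C \<inter> D" by blast+
  then have "prob A + prob B = prob C + prob D" by (simp add: sum sets)
  moreover have "prob B = prob D"
    using measure_fi_iter_translate[where Q = "\<lambda>c. moves_across m c 0" and a = 1, OF sets_moves_across]
    by (simp add: B_def D_def F_def moves_across_def algebra_simps)
  ultimately show ?case using Suc by (simp add: A_def C_def F_def)
qed

section \<open>The flow as a crossing probability\<close>

lemma block_at_car_gap:
  "block_at (True # replicate d False) x s \<longleftrightarrow> s x \<and> (\<forall>i\<in>{1..d}. \<not> s (x + int i))"
proof -
  have "block_at (True # replicate d False) x s
      \<longleftrightarrow> s x \<and> (\<forall>k<d. \<not> s (x + int (Suc k)))"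
    unfolding block_at_def by (auto simp: less_Suc_eq_0_disj)
  also have "(\<forall>k<d. \<not> s (x + int (Suc k))) \<longleftrightarrow> (\<forall>i\<in>Suc ` {..<d}. \<not> s (x + int i))"
    by auto
  also have "Suc ` {..<d} = {1..d}" by (simp add: image_Suc_lessThan)
  finally show ?thesis .
qed

lemma block_at_snoc:
  "block_at (B @ [b]) x s \<longleftrightarrow> block_at B x s \<and> s (x + int (length B)) = b"
  unfolding block_at_def by (auto simp: nth_append less_Suc_eq)

lemma block_prob_snoc:
  "block_prob m \<rho> t B = block_prob m \<rho> t (B @ [True]) + block_prob m \<rho> t (B @ [False])"
proof -
  interpret prob_space "bernoulli_config \<rho>" by (rule prob_space_bernoulli_config)
  define E where "E B' = {s. block_at B' 0 ((fi_step m ^^ t) s)}" for B'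
  have "E B' \<in> events" for B'
    using sets_block_at[of \<rho> B' 0 t m] by (simp add: E_def)
  moreover have "E (B @ [True]) \<inter> E (B @ [False]) = {}" "E B = E (B @ [True]) \<union> E (B @ [False])"
    by (auto simp: E_def block_at_snoc)
  ultimately have "prob (E B) = prob (E (B @ [True])) + prob (E (B @ [False]))"
    using finite_measure_Union by metis
  then show ?thesis by (simp add: block_prob_def E_def)
qed

text \<open>Summation by parts: the mean of the gap truncated at \<open>m\<close> is the sum of the
  tail probabilities of a gap of at least \<open>d\<close>. A block closed by a car is a difference
  of two consecutive tails.\<close>

lemma avg_flow_eq_sum:
  "avg_flow m \<rho> t = (\<Sum>d\<in>{1..m}. block_prob m \<rho> t (True # replicate d False))"
proof -
  let ?e = "\<lambda>d. block_prob m \<rho> t (True # replicate d False)"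
  have gap: "block_prob m \<rho> t (True # replicate k False @ [True]) = ?e k - ?e (Suc k)" for k
    using block_prob_snoc[of m \<rho> t "True # replicate k False"] by (simp add: replicate_append_same)
  have "(\<Sum>k\<in>{1..<n}. real k * (?e k - ?e (Suc k))) + real n * ?e n = (\<Sum>d\<in>{1..n}. ?e d)" for n
  proof (induction n)
    case (Suc n)
    then show ?case by (cases "n = 0") (simp_all add: algebra_simps)
  qed simp
  from this[of m] show ?thesis unfolding avg_flow_def gap .
qed

lemma moves_across_iff_block:
  "moves_across m s x \<longleftrightarrow> (\<exists>d\<in>{1..m}. block_at (True # replicate d False) (x - int d) s)"
proof
  assume a: "moves_across m s x"
  \<comment> \<open>The distance from \<open>x\<close> to the nearest car behind it; this car is the
    one that crosses.\<close>
  define d where "d = (LEAST j. 1 \<le> j \<and> s (x - int j))"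
  obtain j where j: "1 \<le> j" "j \<le> m" "s (x - int j)" using a by (auto simp: moves_across_def)
  then have d: "1 \<le> d" "s (x - int d)"
    unfolding d_def using LeastI[of "\<lambda>j. 1 \<le> j \<and> s (x - int j)" j] by blast+
  have "d \<le> j" unfolding d_def using j by (intro Least_le) blast
  then have "d \<le> m" using j by simp
  moreover have "\<not> s (x - int d + int i)" if i: "i \<in> {1..d}" for i
  proof (cases "i = d")
    case True
    then show ?thesis using a by (simp add: moves_across_def)
  next
    case False
    then have "d - i < d" "1 \<le> d - i" using i by auto
    then have "\<not> s (x - int (d - i))"
      using not_less_Least[of "d - i" "\<lambda>j. 1 \<le> j \<and> s (x - int j)", folded d_def] by blast
    then show ?thesis using i by (simp add: of_nat_diff algebra_simps)
  qed
  ultimately show "\<exists>d\<in>{1..m}. block_at (True # replicate d False) (x - int d) s"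
    using d unfolding block_at_car_gap by auto
next
  assume "\<exists>d\<in>{1..m}. block_at (True # replicate d False) (x - int d) s"
  then obtain d where d: "d \<in> {1..m}" "s (x - int d)" "\<forall>i\<in>{1..d}. \<not> s (x - int d + int i)"
    unfolding block_at_car_gap by blast
  then have "\<not> s x" using bspec[OF d(3), of d] by simp
  then show "moves_across m s x" using d by (auto simp: moves_across_def)
qed

text \<open>Translating the \<open>d\<close>-th tail event by \<open>d\<close> sites makes all of
  them end at site 0. They become disjoint, because the nearest car behind 0 is unique, and their
  union is the crossing event.\<close>

lemma avg_flow_eq_measure:
  "avg_flow m \<rho> t = measure (bernoulli_config \<rho>) {s. moves_across m ((fi_step m ^^ t) s) 0}"
proof -
  interpret prob_space "bernoulli_config \<rho>" by (rule prob_space_bernoulli_config)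
  define E where "E d = {s. block_at (True # replicate d False) (- int d) ((fi_step m ^^ t) s)}" for d
  \<comment> \<open>For \<open>d < d'\<close> the car at \<open>-d\<close> would sit among the sites
    required to be empty after \<open>-d'\<close>.\<close>
  have disj: "E d \<inter> E d' = {}" if "d < d'" for d d'
  proof -
    have "\<not> (c (- int d) \<and> (\<forall>i\<in>{1..d'}. \<not> c (- int d' + int i)))" for c :: config
    proof
      assume c: "c (- int d) \<and> (\<forall>i\<in>{1..d'}. \<not> c (- int d' + int i))"
      show False
      proof (cases "d = 0")
        case True
        then show False using c that by (auto dest!: bspec[where x = d'])
      next
        case False
        then show False using c that by (auto simp: of_nat_diff dest!: bspec[where x = "d' - d"])
      qed
    qed
    then show ?thesis unfolding E_def block_at_car_gap by blast
  qed
  have "{s. moves_across m ((fi_step m ^^ t) s) 0} = (\<Union>d\<in>{1..m}. E d)"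
    by (auto simp: moves_across_iff_block E_def)
  also have "prob \<dots> = (\<Sum>d\<in>{1..m}. prob (E d))"
  proof (rule finite_measure_finite_Union)
    show "E ` {1..m} \<subseteq> events"
      using sets_block_at[of \<rho>] by (auto simp: E_def)
    show "disjoint_family_on E {1..m}"
      unfolding disjoint_family_on_def using disj by (metis Int_commute linorder_neqE_nat)
  qed simp
  also have "\<dots> = avg_flow m \<rho> t"
    unfolding avg_flow_eq_sum E_def by (intro sum.cong refl) (rule block_prob_eq_measure_at[symmetric])
  finally show ?thesis by simp
qed

text \<open>Site 0 is occupied, or is crossed, or ends a run of \<open>m + 1\<close> empty sites;
  these three cases partition the space, and the first has probability \<rho>.\<close>

lemma avg_flow_eq_empty_block:
  assumes m: "m \<ge> 1" and \<rho>: "0 \<le> \<rho>" "\<rho> \<le> 1"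
  shows "avg_flow m \<rho> t
    = 1 - \<rho> - measure (bernoulli_config \<rho>) {s. \<forall>i\<le>m. \<not> (fi_step m ^^ t) s (- int m + int i)}"
proof -
  interpret prob_space "bernoulli_config \<rho>" by (rule prob_space_bernoulli_config)
  define C J Z where "C = {s. (fi_step m ^^ t) s 0}"
    and "J = {s. moves_across m ((fi_step m ^^ t) s) 0}"
    and "Z = {s. \<forall>i\<le>m. \<not> (fi_step m ^^ t) s (- int m + int i)}"
  have Z: "Z = UNIV - (C \<union> J)"
  proof -
    have "(\<forall>i\<le>m. \<not> c (- int m + int i)) \<longleftrightarrow> \<not> c 0 \<and> (\<forall>j\<in>{1..m}. \<not> c (0 - int j))" (is "?L \<longleftrightarrow> ?R")
      for c :: config
    proof
      assume L: ?L
      have "\<not> c (0 - int j)" if "j \<le> m" for j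
        using L[rule_format, of "m - j"] that by (simp add: of_nat_diff)
      from this[of 0] this show ?R by auto
    next
      assume R: ?R
      have "\<not> c (- int m + int i)" if "i \<le> m" for i
        using R that by (cases "i = m") (auto simp: of_nat_diff dest!: bspec[where x = "m - i"])
      then show ?L by blast
    qed
    then show ?thesis unfolding Z_def C_def J_def moves_across_def by auto
  qed
  have sets: "C \<in> events" "J \<in> events"
    unfolding C_def J_def by (rule sets_fi_iter_occupied sets_moves_across)+
  have "prob Z = 1 - prob (C \<union> J)" unfolding Z using prob_compl[of "C \<union> J"] sets by simp
  also have "prob (C \<union> J) = prob C + prob J"
    by (rule finite_measure_Union) (use sets in \<open>auto simp: C_def J_def moves_across_def\<close>)
  also have "prob C = \<rho>" unfolding C_def by (rule density_fi_iter[OF m \<rho>])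
  finally show ?thesis unfolding avg_flow_eq_measure J_def[symmetric] Z_def[symmetric] by simp
qed

lemma avg_flow_closed_form:
  assumes m: "m \<ge> 1" and \<rho>: "0 \<le> \<rho>" "\<rho> \<le> 1"
  shows "avg_flow m \<rho> t = 1 - \<rho> - (\<Sum>j=1..t+1. real j / real (t + 1)
           * real (((m + 1) * (t + 1)) choose (t + 1 - j))
           * \<rho> ^ (t + 1 - j) * (1 - \<rho>) ^ (m * (t + 1) + j))"
proof -
  let ?N = "(m + 1) * (t + 1)"
  let ?g = "\<lambda>k. real (t + 1 - k) / real (t + 1) * real (?N choose k) * \<rho> ^ k * (1 - \<rho>) ^ (?N - k)"
  \<comment> \<open>The block ending at 0 starts at \<open>-m\<close>, and each of the
    \<open>t\<close> steps back moves its start \<open>m\<close> sites further left.\<close>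
  have "{s. \<forall>i\<le>m. \<not> (fi_step m ^^ t) s (- int m + int i)}
      = {s. sparse_from m s (- int m - int (m * t)) ?N}"
    using empty_block_iff_sparse_from[OF m, of t _ "- int m - int (m * t)"] by simp
  then have "measure (bernoulli_config \<rho>) {s. \<forall>i\<le>m. \<not> (fi_step m ^^ t) s (- int m + int i)}
      = (\<Sum>k\<le>t+1. ?g k)"
    using prob_sparse_from[OF \<rho>, of "t + 1" m] by simp
  \<comment> \<open>The term \<open>k = t + 1\<close> carries the factor 0.\<close>
  also have "\<dots> = (\<Sum>k\<le>t. ?g k)" by simp
  also have "\<dots> = (\<Sum>j=1..t+1. real j / real (t + 1) * real (?N choose (t + 1 - j))
           * \<rho> ^ (t + 1 - j) * (1 - \<rho>) ^ (m * (t + 1) + j))"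
  proof (rule sum.reindex_bij_witness[of _ "\<lambda>j. t + 1 - j" "\<lambda>k. t + 1 - k"])
    fix k assume "k \<in> {..t}"
    then have "m * (t + 1) + (t + 1 - k) = ?N - k" "t + 1 - (t + 1 - k) = k" by auto
    then show "real (t + 1 - k) / real (t + 1) * real (?N choose (t + 1 - (t + 1 - k)))
           * \<rho> ^ (t + 1 - (t + 1 - k)) * (1 - \<rho>) ^ (m * (t + 1) + (t + 1 - k)) = ?g k"
      by (simp only:)
  qed auto
  finally show ?thesis using avg_flow_eq_empty_block[OF m \<rho>] by simp
qed

section \<open>Hypergeometric form\<close>

text \<open>The rising factorial of \<open>-t\<close> contains the factor 0 as soon as
  \<open>l > t\<close>.\<close>

lemma hyp2F1_neg_nat:
  "hyp2F1 a (- real t) c z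
     = (\<Sum>l\<le>t. pochhammer a l * pochhammer (- real t) l / pochhammer c l * (z ^ l / fact l))"
  unfolding hyp2F1_def by (rule suminf_finite) (auto simp: pochhammer_of_nat_eq_0_lemma)

lemma pochhammer_of_nat_Suc: "pochhammer (real (Suc M)) l = fact (M + l) / fact M"
  using pochhammer_product'[of "1::real" M l] by (simp add: pochhammer_fact[symmetric] field_simps)

lemma pochhammer_neg_nat:
  "l \<le> t \<Longrightarrow> pochhammer (- real t) l = (- 1) ^ l * (fact t / fact (t - l))"
  using pochhammer_of_nat_Suc[of "t - l" l]
  by (simp add: pochhammer_minus of_nat_diff algebra_simps)

text \<open>The sums agree term by term under \<open>j = l + 1\<close>, once all rising factorials
  are written as quotients of factorials.\<close>

lemma ballot_sum_eq_hyp2F1: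
  fixes \<rho> :: real
  assumes \<rho>: "\<rho> \<noteq> 0"
  shows "(\<Sum>j=1..t+1. real j / real (t + 1) * real ((M + t + 1) choose (t + 1 - j))
            * \<rho> ^ (t + 1 - j) * (1 - \<rho>) ^ (M + j))
    = (1 - \<rho>) ^ (1 + M) * \<rho> ^ t * fact (M + t + 1) / (real (1 + M) * fact (1 + t) * fact M)
        * hyp2F1 2 (- real t) (real (2 + M)) (1 - 1 / \<rho>)"
proof -
  let ?P = "(1 - \<rho>) ^ (1 + M) * \<rho> ^ t * fact (M + t + 1) / (real (1 + M) * fact (1 + t) * fact M)"
  let ?h = "\<lambda>l. pochhammer 2 l * pochhammer (- real t) l / pochhammer (real (2 + M)) l
              * ((1 - 1 / \<rho>) ^ l / fact l)"
  let ?f = "\<lambda>j. real j / real (t + 1) * real ((M + t + 1) choose (t + 1 - j))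
            * \<rho> ^ (t + 1 - j) * (1 - \<rho>) ^ (M + j)"
  have summand: "?f (Suc l) = ?P * ?h l" if l: "l \<le> t" for l
  proof -
    obtain r where r: "t = l + r" using l le_Suc_ex by blast
    have c: "real ((M + t + 1) choose r) = fact (M + t + 1) / (fact r * fact (M + 1 + l))"
      using binomial_fact[of r "M + t + 1", where ?'a = real] r by simp
    have p2: "pochhammer (2::real) l = real (l + 1) * fact l"
      using pochhammer_of_nat_Suc[of 1 l] by simp
    have pM: "pochhammer (real (2 + M)) l = fact (M + 1 + l) / fact (M + 1)"
      using pochhammer_of_nat_Suc[of "M + 1" l] by simp
    have pt: "pochhammer (- real t) l = (- 1) ^ l * (fact t / fact r)"
      using pochhammer_neg_nat[OF l] r by simp
    \<comment> \<open>The sign from the rising factorial of \<open>-t\<close> is absorbed into the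
      argument, which becomes the positive-power ratio of the ballot weights.\<close>
    have "(- 1) * (1 - 1 / \<rho>) = (1 - \<rho>) / \<rho>" using \<rho> by (simp add: field_simps)
    then have z: "(- 1) ^ l * (1 - 1 / \<rho>) ^ l = (1 - \<rho>) ^ l / \<rho> ^ l"
      by (simp only: power_mult_distrib[symmetric] power_divide[symmetric])
    have "?h l = real (l + 1) * (fact t / fact r) * (fact (M + 1) / fact (M + 1 + l))
              * ((- 1) ^ l * (1 - 1 / \<rho>) ^ l)"
      unfolding p2 pt pM by simp
    then have h: "?h l = real (l + 1) * (fact t / fact r) * (fact (M + 1) / fact (M + 1 + l))
              * ((1 - \<rho>) ^ l / \<rho> ^ l)"
      unfolding z .
    have facts: "real (1 + M) * fact (1 + t) * fact M = fact (M + 1) * (real (t + 1) * fact t)"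
      by simp
    have e: "t + 1 - Suc l = r" "M + Suc l = 1 + M + l" using r by simp_all
    have "?f (Suc l) = real (l + 1) / real (t + 1) * (fact (M + t + 1) / (fact r * fact (M + 1 + l)))
              * \<rho> ^ r * ((1 - \<rho>) ^ (1 + M) * (1 - \<rho>) ^ l)"
      unfolding e c by (simp only: power_add Suc_eq_plus1)
    also have "\<dots> = ?P * (real (l + 1) * (fact t / fact r) * (fact (M + 1) / fact (M + 1 + l))
              * ((1 - \<rho>) ^ l / \<rho> ^ l))"
    proof -
      have "\<rho> ^ t = \<rho> ^ l * \<rho> ^ r" using r by (simp add: power_add)
      then show ?thesis
        unfolding facts using \<rho> by (simp add: divide_simps del: fact_Suc of_nat_Suc of_nat_add)
    qed
    finally show ?thesis unfolding h .
  qed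
  have "(\<Sum>j=1..t+1. ?f j) = (\<Sum>j=Suc 0..Suc t. ?f j)"
    by (rule arg_cong[where f = "sum ?f"]) simp
  also have "\<dots> = (\<Sum>l\<le>t. ?f (Suc l))"
    unfolding sum.shift_bounds_cl_Suc_ivl by (simp only: atMost_atLeast0)
  also have "\<dots> = (\<Sum>l\<le>t. ?P * ?h l)"
    by (intro sum.cong refl) (rule summand, simp)
  also have "\<dots> = ?P * (\<Sum>l\<le>t. ?h l)"
    by (rule sum_distrib_left[symmetric])
  finally show ?thesis unfolding hyp2F1_neg_nat .
qed

theorem mainTheorem1:
  fixes m t :: nat and \<rho> :: real
  assumes "m \<ge> 1" and "0 < \<rho>" and "\<rho> \<le> 1"
  shows "avg_flow m \<rho> t =
           1 - \<rho> - (\<Sum>j=1..t+1. real j / real (t + 1)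
                       * real (((m + 1) * (t + 1)) choose (t + 1 - j))
                       * \<rho> ^ (t + 1 - j) * (1 - \<rho>) ^ (m * (t + 1) + j))
       \<and> avg_flow m \<rho> t =
           1 - \<rho> - (1 - \<rho>) ^ (1 + m + m * t) * \<rho> ^ t * fact (1 + m + t + m * t)
                    / (real (1 + m + m * t) * fact (1 + t) * fact (m + m * t))
                    * hyp2F1 2 (- real t) (real (2 + m + m * t)) (1 - 1 / \<rho>)"
proof -
  \<comment> \<open>\<open>M\<close> is the excess of the block length
    \<open>(m + 1) * (t + 1)\<close> over \<open>t + 1\<close>; in terms of it the two closed forms
    share their parameters.\<close>
  define M where "M = m * (t + 1)"
  have M: "(m + 1) * (t + 1) = M + t + 1" "1 + m + m * t = 1 + M" "1 + m + t + m * t = M + t + 1"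
    "m + m * t = M" "2 + m + m * t = 2 + M" "m * (t + 1) = M"
    by (simp_all add: M_def)
  have \<rho>: "\<rho> \<noteq> 0" "0 \<le> \<rho>" using assms by auto
  show ?thesis
    using avg_flow_closed_form[OF assms(1) \<rho>(2) assms(3), of t] ballot_sum_eq_hyp2F1[OF \<rho>(1), of t M]
    unfolding M by (simp only:)
qed

end
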